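(* Let $S$ and $R$ be rings and let $f:S\rightarrow R$ be a ring homomorphism with $f[S]\subseteq Z(R)$. Assume that $f$ is unitary and satisfies GU, GD and SGB. Let $\mathcal C=\{Q_\alpha\}_{\alpha\in I}$ be a maximal chain of prime ideals in $\mathrm{Spec}(R)$. Then $\mathcal D=\{f^{-1}[Q_\alpha]\}_{\alpha\in I}$ is a maximal chain of prime ideals in $\mathrm{Spec}(S)$. (In other words, every maximal chain in $\mathrm{Spec}(R)$ is a cover of some maximal chain in $\mathrm{Spec}(S)$.)
   Context: Rings are nontrivial, associative, with identity, not necessarily commutative; unitary means $f(1)=1$. $Z(R)$ is the center of $R$. $\mathrm{Spec}$ denotes the set of prime (two-sided, proper) ideals: $P$ is prime if $aRb\subseteq P$ implies $a\in P$ or $b\in P$. $\subset$ means proper inclusion. All chains are with respect to containment; a maximal chain in $\mathrm{Spec}$ is one not properly contained in another chain of prime ideals. An ideal $Q$ of $R$ lies over an ideal $P$ of $S$ if $f^{-1}[Q]=P$. GD: for any $P_1\subset P_2$ in $\mathrm{Spec}(S)$ and every $Q_2\in\mathrm{Spec}(R)$ lying over $P_2$, there is $Q_1\subset Q_2$ in $\mathrm{Spec}(R)$ lying over $P_1$. GU: for any $P_1\subset P_2$ in $\mathrm{Spec}(S)$ and every $Q_1\in\mathrm{Spec}(R)$ lying over $P_1$, there is $Q_2\in\mathrm{Spec}(R)$ with $Q_1\subset Q_2$ lying over $P_2$. SGB: for any $P_1\subset P_2\subset P_3$ in $\mathrm{Spec}(S)$ and every $Q_1\subset Q_3$ in $\mathrm{Spec}(R)$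 with $Q_1$ lying over $P_1$ and $Q_3$ lying over $P_3$, there is $Q_2\in\mathrm{Spec}(R)$ with $Q_1\subset Q_2\subset Q_3$ lying over $P_2$. A chain $\mathcal C\subseteq\mathrm{Spec}(R)$ is a cover of a chain $\mathcal D\subseteq\mathrm{Spec}(S)$ if $f^{-1}[Q]\in\mathcal D$ for every $Q\in\mathcal C$ and the map $Q\mapsto f^{-1}[Q]$ from $\mathcal C$ to $\mathcal D$ is surjective. *)

theory Defs
  imports "HOL-Algebra.Algebra"
begin

text \<open>
  The library's \<^locale>\<open>primeideal\<close> extends \<^locale>\<open>cring\<close> and uses the elementwise condition.
  Here rings need not be commutative, so primeness is the condition
  "\<open>a R b \<subseteq> P\<close> implies \<open>a \<in> P\<close> or \<open>b \<in> P\<close>". The locale \<^locale>\<open>ideal\<close> describes two-sided ideals.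
\<close>

definition Spec :: "('a, 'm) ring_scheme \<Rightarrow> 'a set set" where
  "Spec R = {P. ideal P R \<and> P \<noteq> carrier R \<and>
     (\<forall>a\<in>carrier R. \<forall>b\<in>carrier R.
        {a \<otimes>\<^bsub>R\<^esub> r \<otimes>\<^bsub>R\<^esub> b | r. r \<in> carrier R} \<subseteq> P \<longrightarrow> a \<in> P \<or> b \<in> P)}"

definition ring_center :: "('a, 'm) ring_scheme \<Rightarrow> 'a set" where
  "ring_center R = {z \<in> carrier R. \<forall>r\<in>carrier R. z \<otimes>\<^bsub>R\<^esub> r = r \<otimes>\<^bsub>R\<^esub> z}"

text \<open>
  The preimage of \<open>Q\<close> under \<open>f : S \<rightarrow> R\<close>. The HOL function \<open>f\<close> is total on its type, so the
  preimage is cut down to the carrier of \<open>S\<close>.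
\<close>

definition preim :: "('a, 'm) ring_scheme \<Rightarrow> ('a \<Rightarrow> 'b) \<Rightarrow> 'b set \<Rightarrow> 'a set" where
  "preim S f Q = {x \<in> carrier S. f x \<in> Q}"

definition lies_over :: "('a, 'm) ring_scheme \<Rightarrow> ('a \<Rightarrow> 'b) \<Rightarrow> 'b set \<Rightarrow> 'a set \<Rightarrow> bool" where
  "lies_over S f Q P \<longleftrightarrow> preim S f Q = P"

definition GD :: "('a, 'm) ring_scheme \<Rightarrow> ('b, 'n) ring_scheme \<Rightarrow> ('a \<Rightarrow> 'b) \<Rightarrow> bool" where
  "GD S R f \<longleftrightarrow>
     (\<forall>P1\<in>Spec S. \<forall>P2\<in>Spec S. \<forall>Q2\<in>Spec R. P1 \<subset> P2 \<and> lies_over S f Q2 P2 \<longrightarrow>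
        (\<exists>Q1\<in>Spec R. Q1 \<subset> Q2 \<and> lies_over S f Q1 P1))"

definition GU :: "('a, 'm) ring_scheme \<Rightarrow> ('b, 'n) ring_scheme \<Rightarrow> ('a \<Rightarrow> 'b) \<Rightarrow> bool" where
  "GU S R f \<longleftrightarrow>
     (\<forall>P1\<in>Spec S. \<forall>P2\<in>Spec S. \<forall>Q1\<in>Spec R. P1 \<subset> P2 \<and> lies_over S f Q1 P1 \<longrightarrow>
        (\<exists>Q2\<in>Spec R. Q1 \<subset> Q2 \<and> lies_over S f Q2 P2))"

definition SGB :: "('a, 'm) ring_scheme \<Rightarrow> ('b, 'n) ring_scheme \<Rightarrow> ('a \<Rightarrow> 'b) \<Rightarrow> bool" where
  "SGB S R f \<longleftrightarrow>
     (\<forall>P1\<in>Spec S. \<forall>P2\<in>Spec S. \<forall>P3\<in>Spec S. \<forall>Q1\<in>Spec R. \<forall>Q3\<in>Spec R.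
        P1 \<subset> P2 \<and> P2 \<subset> P3 \<and> Q1 \<subset> Q3 \<and> lies_over S f Q1 P1 \<and> lies_over S f Q3 P3 \<longrightarrow>
        (\<exists>Q2\<in>Spec R. Q1 \<subset> Q2 \<and> Q2 \<subset> Q3 \<and> lies_over S f Q2 P2))"

definition chain_cover ::
  "('a, 'm) ring_scheme \<Rightarrow> ('b, 'n) ring_scheme \<Rightarrow> ('a \<Rightarrow> 'b) \<Rightarrow> 'b set set \<Rightarrow> 'a set set \<Rightarrow> bool" where
  "chain_cover S R f \<C> \<D> \<longleftrightarrow>
     subset.chain (Spec R) \<C> \<and> subset.chain (Spec S) \<D> \<and>
     (\<forall>Q\<in>\<C>. preim S f Q \<in> \<D>) \<and> (\<forall>P\<in>\<D>. \<exists>Q\<in>\<C>. preim S f Q = P)"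

end

theory Submission
  imports Defs
begin

text \<open>
  Suppose a prime \<open>P\<close> of \<open>S\<close> could be added to the contracted chain. It cuts \<open>\<C>\<close> into the set \<open>A\<close>
  of members contracting strictly below \<open>P\<close> and the set \<open>B\<close> of members contracting strictly above
  \<open>P\<close>. It suffices that \<open>A\<close> has a largest and \<open>B\<close> a smallest member whenever they are nonempty: GU, GD
  or SGB then gives a prime over \<open>P\<close> which fits into the gap of \<open>\<C>\<close>. For \<open>B\<close> the intersection is
  prime. The union of a chain of primes, however, need not be prime in a noncommutative ring. Instead,
  the products of elements of \<open>f[S - P]\<close> with elements outside \<open>\<Inter>B\<close> form an m-system, because \<open>f[S]\<close>
  is central, and this m-system avoids \<open>\<Union>A\<close>. Hence a prime \<open>N\<close> with \<open>\<Union>A \<subseteq> N \<subseteq> \<Inter>B\<close> contracts into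
  \<open>P\<close>; by maximality of \<open>\<C>\<close> it lies in \<open>\<C>\<close>, and so it is the largest member of \<open>A\<close>.
\<close>

section \<open>Prime ideals of rings that need not be commutative\<close>

lemma SpecD:
  assumes "P \<in> Spec R"
  shows "ideal P R" "P \<noteq> carrier R"
    and "\<And>a b. \<lbrakk>a \<in> carrier R; b \<in> carrier R; \<And>r. r \<in> carrier R \<Longrightarrow> a \<otimes>\<^bsub>R\<^esub> r \<otimes>\<^bsub>R\<^esub> b \<in> P\<rbrakk>
      \<Longrightarrow> a \<in> P \<or> b \<in> P"
  using assms unfolding Spec_def by auto

lemma SpecI:
  assumes "ideal P R" "P \<noteq> carrier R"
    and "\<And>a b. \<lbrakk>a \<in> carrier R; b \<in> carrier R; \<And>r. r \<in> carrier R \<Longrightarrow> a \<otimes>\<^bsub>R\<^esub> r \<otimes>\<^bsub>R\<^esub> b \<in> P\<rbrakk>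
      \<Longrightarrow> a \<in> P \<or> b \<in> P"
  shows "P \<in> Spec R"
  unfolding Spec_def
proof (safe intro!: assms(1))
  fix a b
  assume "a \<in> carrier R" "b \<in> carrier R" "b \<notin> P"
    "{a \<otimes>\<^bsub>R\<^esub> r \<otimes>\<^bsub>R\<^esub> b | r. r \<in> carrier R} \<subseteq> P"
  then show "a \<in> P"
    using assms(3)[of a b] by blast
qed (use assms(2) in auto)

lemma Spec_subset_carrier: "P \<in> Spec R \<Longrightarrow> P \<subseteq> carrier R"
  using SpecD(1) ideal.Icarr by fastforce

lemma Spec_one_notin:
  assumes "P \<in> Spec R"
  shows "\<one>\<^bsub>R\<^esub> \<notin> P"
  using SpecD(1,2)[OF assms] ideal.one_imp_carrier by blast

section \<open>m-systems, the noncommutative analogue of multiplicative sets, and primes avoiding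
  them\<close>

definition m_system :: "('a, 'm) ring_scheme \<Rightarrow> 'a set \<Rightarrow> bool" where
  "m_system R W \<longleftrightarrow> W \<subseteq> carrier R \<and>
     (\<forall>x\<in>W. \<forall>y\<in>W. \<exists>r\<in>carrier R. x \<otimes>\<^bsub>R\<^esub> r \<otimes>\<^bsub>R\<^esub> y \<in> W)"

lemma m_system_Compl_prime:
  assumes "P \<in> Spec R"
  shows "m_system R (carrier R - P)"
proof -
  interpret ideal P R by (rule SpecD(1)[OF assms])
  show ?thesis
    unfolding m_system_def using SpecD(3)[OF assms] by (metis Diff_iff Diff_subset m_closed)
qed

lemma (in ring) m_system_one: "m_system R {\<one>}"
  unfolding m_system_def by auto

text \<open>This ideal and its mirror image below serve to enlarge an ideal \<open>N\<close> maximal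
  among those avoiding an m-system. Absorption on the left comes from \<open>N\<close>; absorption
  on the right holds because the middle factor \<open>r\<close> ranges over the whole ring.\<close>

lemma (in ring) ideal_quotient_left:
  assumes "ideal N R" "b \<in> carrier R"
  shows "ideal {x \<in> carrier R. \<forall>r\<in>carrier R. x \<otimes> r \<otimes> b \<in> N} R"
proof -
  interpret N: ideal N R by fact
  show ?thesis
  proof (rule idealI[OF ring_axioms])
    show "subgroup {x \<in> carrier R. \<forall>r\<in>carrier R. x \<otimes> r \<otimes> b \<in> N} (add_monoid R)"
      by (rule add.subgroupI)
        (use assms(2) in \<open>auto simp: l_distr l_minus simp flip: a_inv_def intro: exI[of _ \<zero>]\<close>)
  next
    fix x s assume x: "x \<in> {x \<in> carrier R. \<forall>r\<in>carrier R. x \<otimes> r \<otimes> b \<in> N}" and s: "s \<in> carrier R"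
    have "s \<otimes> x \<otimes> r \<otimes> b = s \<otimes> (x \<otimes> r \<otimes> b)" "x \<otimes> s \<otimes> r \<otimes> b = x \<otimes> (s \<otimes> r) \<otimes> b"
      if "r \<in> carrier R" for r
      using that x s assms(2) by (auto simp: m_assoc)
    then show "s \<otimes> x \<in> {x \<in> carrier R. \<forall>r\<in>carrier R. x \<otimes> r \<otimes> b \<in> N}"
      and "x \<otimes> s \<in> {x \<in> carrier R. \<forall>r\<in>carrier R. x \<otimes> r \<otimes> b \<in> N}"
      using x s N.I_l_closed by auto
  qed
qed

lemma (in ring) ideal_quotient_right:
  assumes "ideal N R" "a \<in> carrier R"
  shows "ideal {x \<in> carrier R. \<forall>r\<in>carrier R. a \<otimes> r \<otimes> x \<in> N} R"
proof -
  interpret N: ideal N R by fact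
  show ?thesis
  proof (rule idealI[OF ring_axioms])
    show "subgroup {x \<in> carrier R. \<forall>r\<in>carrier R. a \<otimes> r \<otimes> x \<in> N} (add_monoid R)"
      by (rule add.subgroupI)
        (use assms(2) in \<open>auto simp: r_distr r_minus simp flip: a_inv_def intro: exI[of _ \<zero>]\<close>)
  next
    fix x s assume x: "x \<in> {x \<in> carrier R. \<forall>r\<in>carrier R. a \<otimes> r \<otimes> x \<in> N}" and s: "s \<in> carrier R"
    have "a \<otimes> r \<otimes> (s \<otimes> x) = a \<otimes> (r \<otimes> s) \<otimes> x" "a \<otimes> r \<otimes> (x \<otimes> s) = a \<otimes> r \<otimes> x \<otimes> s"
      if "r \<in> carrier R" for r
      using that x s assms(2) by (auto simp: m_assoc)
    then show "s \<otimes> x \<in> {x \<in> carrier R. \<forall>r\<in>carrier R. a \<otimes> r \<otimes> x \<in> N}"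
      and "x \<otimes> s \<in> {x \<in> carrier R. \<forall>r\<in>carrier R. a \<otimes> r \<otimes> x \<in> N}"
      using x s N.I_r_closed by auto
  qed
qed

text \<open>By Zorn there is an ideal \<open>N\<close> maximal among those that contain
  \<open>U\<close> and avoid \<open>W\<close>. If it were not prime, two successive enlargements
  would produce w and v in \<open>W\<close> with w R v inside \<open>N\<close>, which the m-system
  property forbids.\<close>

lemma (in ring) ex_prime_avoiding_m_system:
  assumes U: "ideal U R" and W: "m_system R W" "W \<noteq> {}" and UW: "U \<inter> W = {}"
  shows "\<exists>N\<in>Spec R. U \<subseteq> N \<and> N \<inter> W = {}"
proof -
  let ?F = "{N. ideal N R \<and> U \<subseteq> N \<and> N \<inter> W = {}}"
  have "\<exists>N\<in>?F. \<forall>I\<in>?F. N \<subseteq> I \<longrightarrow> I = N"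
  proof (rule subset_Zorn_nonempty)
    show "?F \<noteq> {}" using U UW by blast
    fix \<K> assume ne: "\<K> \<noteq> {}" and \<K>: "subset.chain ?F \<K>"
    then have "subset.chain {I. ideal I R} \<K>"
      unfolding subset_chain_def by blast
    \<comment> \<open>\<open>chain_Union_is_ideal\<close> assigns the zero ideal to the empty chain,
      so nonemptiness selects the union.\<close>
    then have "ideal (\<Union>\<K>) R"
      using chain_Union_is_ideal[of \<K>] ne by simp
    then show "\<Union>\<K> \<in> ?F"
      using ne \<K> unfolding subset_chain_def by blast
  qed
  then obtain N where "N \<in> ?F" and maxF: "\<forall>I\<in>?F. N \<subseteq> I \<longrightarrow> I = N" by (elim bexE)
  then have N: "ideal N R" "U \<subseteq> N" "N \<inter> W = {}" by auto
  have max: "I \<inter> W \<noteq> {}" if "ideal I R" "N \<subset> I" for I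
    using maxF that N(2) by blast
  interpret N: ideal N R by (rule N(1))
  have "N \<in> Spec R"
  proof (rule SpecI[OF N(1)])
    show "N \<noteq> carrier R"
      using N(3) W unfolding m_system_def by blast
    fix a b
    assume ab: "a \<in> carrier R" "b \<in> carrier R"
      and N_ab: "\<And>r. r \<in> carrier R \<Longrightarrow> a \<otimes> r \<otimes> b \<in> N"
    show "a \<in> N \<or> b \<in> N"
    proof (rule ccontr)
      assume contra: "\<not> (a \<in> N \<or> b \<in> N)"
      let ?J = "{x \<in> carrier R. \<forall>r\<in>carrier R. x \<otimes> r \<otimes> b \<in> N}"
      \<comment> \<open>The inclusion is proper because a lies in \<open>?J\<close> but not in
        \<open>N\<close>; hence \<open>?J\<close> meets \<open>W\<close>.\<close>
      have "N \<subset> ?J"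
        using contra ab N_ab N.I_r_closed N.Icarr by auto
      then obtain w where w: "w \<in> W" "w \<in> carrier R"
        "\<And>r. r \<in> carrier R \<Longrightarrow> w \<otimes> r \<otimes> b \<in> N"
        using max[OF ideal_quotient_left[OF N(1) ab(2)]] by blast
      let ?K = "{x \<in> carrier R. \<forall>r\<in>carrier R. w \<otimes> r \<otimes> x \<in> N}"
      \<comment> \<open>Now b is the new element: it lies in \<open>?K\<close> by the choice of
        w.\<close>
      have "N \<subset> ?K"
        using contra ab w N.I_l_closed N.Icarr by auto
      then obtain v where "v \<in> W" "\<And>r. r \<in> carrier R \<Longrightarrow> w \<otimes> r \<otimes> v \<in> N"
        using max[OF ideal_quotient_right[OF N(1) w(2)]] by blast
      then show False
        using W(1) w(1) N(3) unfolding m_system_def by blast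
    qed
  qed
  then show ?thesis using N by blast
qed

section \<open>Chains of primes and maximality\<close>

lemma (in ring) Inter_chain_in_Spec:
  assumes "subset.chain (Spec R) \<B>" "\<B> \<noteq> {}"
  shows "\<Inter>\<B> \<in> Spec R"
proof (rule SpecI)
  show "ideal (\<Inter>\<B>) R"
    using assms SpecD(1) by (intro i_Intersect) (auto simp: subset_chain_def)
  obtain Q where "Q \<in> \<B>" "Q \<in> Spec R"
    using assms unfolding subset_chain_def by blast
  then show "\<Inter>\<B> \<noteq> carrier R"
    using Spec_one_notin[of Q R] by (metis InterE one_closed)
  fix a b
  assume ab: "a \<in> carrier R" "b \<in> carrier R" "\<And>r. r \<in> carrier R \<Longrightarrow> a \<otimes> r \<otimes> b \<in> \<Inter>\<B>"
  have *: "a \<in> Q \<or> b \<in> Q" if "Q \<in> \<B>" for Q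
    using assms(1) that ab SpecD(3)[of Q R a b] unfolding subset_chain_def by blast
  show "a \<in> \<Inter>\<B> \<or> b \<in> \<Inter>\<B>"
  proof (rule ccontr)
    assume "\<not> (a \<in> \<Inter>\<B> \<or> b \<in> \<Inter>\<B>)"
    \<comment> \<open>The smaller of Q and Q' contains neither a nor b, against
      \<open>*\<close>.\<close>
    then obtain Q Q' where "Q \<in> \<B>" "a \<notin> Q" "Q' \<in> \<B>" "b \<notin> Q'" by blast
    then show False
      using * assms(1) unfolding subset_chain_def by blast
  qed
qed

lemma maxchain_memI:
  fixes F C :: "'a set set"
  assumes "subset.maxchain F C" "N \<in> F" "\<And>Q. Q \<in> C \<Longrightarrow> Q \<subseteq> N \<or> N \<subseteq> Q"
  shows "N \<in> C"
proof (rule ccontr)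
  assume "N \<notin> C"
  then have "C \<subset> insert N C" by blast
  moreover have "subset.chain F (insert N C)"
    using assms by (auto simp: subset_chain_insert subset.maxchain_def)
  ultimately show False
    using assms(1) unfolding subset.maxchain_def by blast
qed

section \<open>Contraction of primes along a homomorphism with central image\<close>

locale central_hom = S: ring S + R: ring R
  for S :: "('a, 'm) ring_scheme" and R :: "('b, 'n) ring_scheme" +
  fixes f :: "'a \<Rightarrow> 'b"
  assumes hom: "f \<in> ring_hom S R" and central: "f ` carrier S \<subseteq> ring_center R"
begin

lemma f_closed: "x \<in> carrier S \<Longrightarrow> f x \<in> carrier R"
  using hom ring_hom_closed by fast

lemma f_comm: "\<lbrakk>x \<in> carrier S; r \<in> carrier R\<rbrakk> \<Longrightarrow> f x \<otimes>\<^bsub>R\<^esub> r = r \<otimes>\<^bsub>R\<^esub> f x"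
  using central unfolding ring_center_def by blast

text \<open>Since f a is central, f a r f b = r (f a f b). Thus the single product f a f b in
  \<open>Q\<close> already puts all of f a R f b into \<open>Q\<close>.\<close>

lemma preim_in_Spec:
  assumes "Q \<in> Spec R"
  shows "preim S f Q \<in> Spec S"
proof (rule SpecI)
  interpret Q: ideal Q R by (rule SpecD(1)[OF assms])
  have "ring_hom_ring S R f"
    using hom by (simp add: ring_hom_ringI2 S.ring_axioms R.ring_axioms)
  then show "ideal (preim S f Q) S"
    unfolding preim_def by (rule ring_hom_ring.ideal_vimage) (rule SpecD(1)[OF assms])
  \<comment> \<open>Unitarity, which is part of \<open>ring_hom\<close>, enters here: a contraction
    equal to S would put the one of R into \<open>Q\<close>.\<close>
  show "preim S f Q \<noteq> carrier S"
    using Spec_one_notin[OF assms] ring_hom_one[OF hom] S.one_closed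
    unfolding preim_def by force
  fix a b
  assume ab: "a \<in> carrier S" "b \<in> carrier S"
    and Q_ab: "\<And>r. r \<in> carrier S \<Longrightarrow> a \<otimes>\<^bsub>S\<^esub> r \<otimes>\<^bsub>S\<^esub> b \<in> preim S f Q"
  have ab_Q: "f a \<otimes>\<^bsub>R\<^esub> f b \<in> Q"
    using Q_ab[OF S.one_closed] ab by (simp add: preim_def ring_hom_mult[OF hom])
  have "f a \<otimes>\<^bsub>R\<^esub> r \<otimes>\<^bsub>R\<^esub> f b \<in> Q" if r: "r \<in> carrier R" for r
  proof -
    have "f a \<otimes>\<^bsub>R\<^esub> r \<otimes>\<^bsub>R\<^esub> f b = r \<otimes>\<^bsub>R\<^esub> (f a \<otimes>\<^bsub>R\<^esub> f b)"
      using ab r by (simp add: f_comm[of a r] f_closed R.m_assoc)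
    then show ?thesis using Q.I_l_closed[OF ab_Q r] by simp
  qed
  then show "a \<in> preim S f Q \<or> b \<in> preim S f Q"
    using SpecD(3)[OF assms, of "f a" "f b"] ab f_closed unfolding preim_def by blast
qed

lemma m_system_central_mult:
  assumes P: "P \<in> Spec S" and M: "m_system R M"
  shows "m_system R {f x \<otimes>\<^bsub>R\<^esub> m | x m. x \<in> carrier S - P \<and> m \<in> M}" (is "m_system R ?W")
  unfolding m_system_def
proof (intro conjI ballI)
  have MR: "M \<subseteq> carrier R" using M unfolding m_system_def by blast
  then show "?W \<subseteq> carrier R" using f_closed by blast
  fix u v assume "u \<in> ?W" "v \<in> ?W"
  then obtain x m y n where x: "x \<in> carrier S - P" "m \<in> M" "u = f x \<otimes>\<^bsub>R\<^esub> m"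
    and y: "y \<in> carrier S - P" "n \<in> M" "v = f y \<otimes>\<^bsub>R\<^esub> n"
    by blast
  obtain s where s: "s \<in> carrier S" "x \<otimes>\<^bsub>S\<^esub> s \<otimes>\<^bsub>S\<^esub> y \<in> carrier S - P"
    using m_system_Compl_prime[OF P] x y unfolding m_system_def by blast
  obtain r where r: "r \<in> carrier R" "m \<otimes>\<^bsub>R\<^esub> r \<otimes>\<^bsub>R\<^esub> n \<in> M"
    using M x y unfolding m_system_def by blast
  have car: "m \<in> carrier R" "n \<in> carrier R" "f x \<in> carrier R" "f y \<in> carrier R" "f s \<in> carrier R"
    using x y s MR f_closed by auto
  \<comment> \<open>The middle factor joins the witness s for the complement of \<open>P\<close> to
    the witness r for \<open>M\<close>. The central factors then move left, leaving f (x s y) times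
    m r n.\<close>
  have "u \<otimes>\<^bsub>R\<^esub> (f s \<otimes>\<^bsub>R\<^esub> r) \<otimes>\<^bsub>R\<^esub> v = f x \<otimes>\<^bsub>R\<^esub> (m \<otimes>\<^bsub>R\<^esub> f s) \<otimes>\<^bsub>R\<^esub> (r \<otimes>\<^bsub>R\<^esub> f y) \<otimes>\<^bsub>R\<^esub> n"
    using x y r car by (simp add: R.m_assoc)
  also have "\<dots> = f x \<otimes>\<^bsub>R\<^esub> (f s \<otimes>\<^bsub>R\<^esub> m) \<otimes>\<^bsub>R\<^esub> (f y \<otimes>\<^bsub>R\<^esub> r) \<otimes>\<^bsub>R\<^esub> n"
    using f_comm[of s m] f_comm[of y r] s y r car by simp
  also have "\<dots> = f x \<otimes>\<^bsub>R\<^esub> f s \<otimes>\<^bsub>R\<^esub> (m \<otimes>\<^bsub>R\<^esub> f y) \<otimes>\<^bsub>R\<^esub> (r \<otimes>\<^bsub>R\<^esub> n)"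
    using r car by (simp add: R.m_assoc)
  also have "\<dots> = f x \<otimes>\<^bsub>R\<^esub> f s \<otimes>\<^bsub>R\<^esub> (f y \<otimes>\<^bsub>R\<^esub> m) \<otimes>\<^bsub>R\<^esub> (r \<otimes>\<^bsub>R\<^esub> n)"
    using f_comm[of y m] y car by simp
  also have "\<dots> = f (x \<otimes>\<^bsub>S\<^esub> s \<otimes>\<^bsub>S\<^esub> y) \<otimes>\<^bsub>R\<^esub> (m \<otimes>\<^bsub>R\<^esub> r \<otimes>\<^bsub>R\<^esub> n)"
    using x y s r car by (simp add: R.m_assoc ring_hom_mult[OF hom])
  finally show "\<exists>r\<in>carrier R. u \<otimes>\<^bsub>R\<^esub> r \<otimes>\<^bsub>R\<^esub> v \<in> ?W"
    using s r car by (intro bexI[of _ "f s \<otimes>\<^bsub>R\<^esub> r"]) auto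
qed

text \<open>The set \<open>M\<close> keeps the upper bound on N abstract. The m-system
  \<open>?W\<close> contains \<open>M\<close> (take x = 1) and f[S - P] (take m = 1), so one prime
  avoiding \<open>?W\<close> satisfies both requirements.\<close>

lemma ex_prime_above_chain:
  assumes P: "P \<in> Spec S"
    and A: "subset.chain (Spec R) A" "A \<noteq> {}" "\<And>Q. Q \<in> A \<Longrightarrow> preim S f Q \<subseteq> P"
    and M: "m_system R M" "\<one>\<^bsub>R\<^esub> \<in> M" "\<And>Q. Q \<in> A \<Longrightarrow> Q \<inter> M = {}"
  shows "\<exists>N\<in>Spec R. \<Union>A \<subseteq> N \<and> N \<inter> M = {} \<and> preim S f N \<subseteq> P"
proof -
  let ?W = "{f x \<otimes>\<^bsub>R\<^esub> m | x m. x \<in> carrier S - P \<and> m \<in> M}"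
  have MR: "M \<subseteq> carrier R" using M(1) unfolding m_system_def by blast
  have one: "\<one>\<^bsub>S\<^esub> \<in> carrier S - P" using Spec_one_notin[OF P] by simp
  have M_W: "M \<subseteq> ?W"
  proof
    fix m assume "m \<in> M"
    moreover from this have "m = f \<one>\<^bsub>S\<^esub> \<otimes>\<^bsub>R\<^esub> m"
      using MR by (auto simp: ring_hom_one[OF hom])
    ultimately show "m \<in> ?W" using one by blast
  qed
  have f_W: "f x \<in> ?W" if "x \<in> carrier S - P" for x
  proof -
    have "f x = f x \<otimes>\<^bsub>R\<^esub> \<one>\<^bsub>R\<^esub>" using that f_closed by simp
    then show ?thesis using that M(2) by blast
  qed
  have "subset.chain {I. ideal I R} A"
    using A(1) SpecD(1) unfolding subset_chain_def by blast
  then have U: "ideal (\<Union>A) R"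
    using R.chain_Union_is_ideal[of A] A(2) by simp
  have "\<Union>A \<inter> ?W = {}"
  proof (rule ccontr)
    assume "\<Union>A \<inter> ?W \<noteq> {}"
    then obtain Q x m where Q: "Q \<in> A" "f x \<otimes>\<^bsub>R\<^esub> m \<in> Q" and x: "x \<in> carrier S - P" and m: "m \<in> M"
      by blast
    have QR: "Q \<in> Spec R" using A(1) Q(1) unfolding subset_chain_def by blast
    interpret Q: ideal Q R by (rule SpecD(1)[OF QR])
    have car: "f x \<in> carrier R" "m \<in> carrier R" using x m MR f_closed by auto
    \<comment> \<open>By centrality the one product puts all of f x R m into Q. Primeness then gives
      f x in Q, hence x in \<open>P\<close>, or m in Q; both are excluded.\<close>
    have "f x \<otimes>\<^bsub>R\<^esub> r \<otimes>\<^bsub>R\<^esub> m \<in> Q" if r: "r \<in> carrier R" for r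
    proof -
      have "f x \<otimes>\<^bsub>R\<^esub> r \<otimes>\<^bsub>R\<^esub> m = r \<otimes>\<^bsub>R\<^esub> (f x \<otimes>\<^bsub>R\<^esub> m)"
        using x r car by (simp add: f_comm[of x r] R.m_assoc)
      then show ?thesis using Q.I_l_closed[OF Q(2) r] by simp
    qed
    then have "f x \<in> Q \<or> m \<in> Q" by (rule SpecD(3)[OF QR car])
    then show False
      using A(3)[OF Q(1)] M(3)[OF Q(1)] x m unfolding preim_def by blast
  qed
  then obtain N where "N \<in> Spec R" "\<Union>A \<subseteq> N" "N \<inter> ?W = {}"
    using R.ex_prime_avoiding_m_system[OF U m_system_central_mult[OF P M(1)]] M(2) M_W by blast
  then show ?thesis
    using M_W f_W unfolding preim_def by blast
qed

text \<open>This is the core of maximality below: \<open>comp\<close> says that \<open>P\<close>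
  could be added to the contracted chain, and the conclusion that it is already there.\<close>

lemma maxchain_lies_over_comparable:
  assumes GU: "GU S R f" and GD: "GD S R f" and SGB: "SGB S R f"
    and nontriv: "\<one>\<^bsub>R\<^esub> \<noteq> \<zero>\<^bsub>R\<^esub>"
    and max: "subset.maxchain (Spec R) C"
    and P: "P \<in> Spec S" and comp: "\<And>Q. Q \<in> C \<Longrightarrow> preim S f Q \<subseteq> P \<or> P \<subseteq> preim S f Q"
  shows "\<exists>Q\<in>C. preim S f Q = P"
proof (rule ccontr)
  assume "\<not> ?thesis"
  then have nP: "\<And>Q. Q \<in> C \<Longrightarrow> preim S f Q \<noteq> P" by blast
  define A where "A = {Q \<in> C. preim S f Q \<subset> P}"
  define B where "B = {Q \<in> C. P \<subset> preim S f Q}"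
  have chain: "subset.chain (Spec R) C" using max unfolding subset.maxchain_def by blast
  then have CR: "\<And>Q. Q \<in> C \<Longrightarrow> Q \<in> Spec R"
    and lin: "\<And>Q Q'. \<lbrakk>Q \<in> C; Q' \<in> C\<rbrakk> \<Longrightarrow> Q \<subseteq> Q' \<or> Q' \<subseteq> Q"
    unfolding subset_chain_def by blast+
  have chainA: "subset.chain (Spec R) A" and chainB: "subset.chain (Spec R) B"
    using chain unfolding subset_chain_def A_def B_def by blast+
  have split: "Q \<in> A \<or> Q \<in> B" if "Q \<in> C" for Q
    using comp[OF that] nP[OF that] that unfolding A_def B_def by blast
  have mono: "preim S f Q \<subseteq> preim S f Q'" if "Q \<subseteq> Q'" for Q Q'
    using that unfolding preim_def by blast
  have below: "Q \<subset> Q'" if "Q \<in> A" "Q' \<in> B" for Q Q'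
    using that lin[of Q Q'] mono[of Q' Q] unfolding A_def B_def by blast
  have gap: "N \<in> C" if "N \<in> Spec R" "\<And>Q. Q \<in> A \<Longrightarrow> Q \<subseteq> N" "\<And>Q. Q \<in> B \<Longrightarrow> N \<subseteq> Q" for N
    using maxchain_memI[OF max that(1)] split that(2,3) by blast
  \<comment> \<open>Such a prime would belong to \<open>C\<close> by maximality and lie over
    \<open>P\<close>, against \<open>nP\<close>. Each of the three final cases produces one.\<close>
  have no_gap: "\<not> (\<exists>N\<in>Spec R. (\<forall>Q\<in>A. Q \<subseteq> N) \<and> (\<forall>Q\<in>B. N \<subseteq> Q) \<and> lies_over S f N P)"
    using gap nP unfolding lies_over_def by blast
  have least: "\<exists>Q\<in>B. \<forall>Q'\<in>B. Q \<subseteq> Q'" if "B \<noteq> {}"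
  proof -
    \<comment> \<open>The intersection fits the gap, so it is a member of \<open>C\<close>; as its
      contraction contains \<open>P\<close> and differs from it, it belongs to
      \<open>B\<close>.\<close>
    have "P \<subseteq> preim S f (\<Inter>B)"
      using Spec_subset_carrier[OF P] that unfolding B_def preim_def by blast
    moreover have "\<Inter>B \<in> C"
      using below by (intro gap R.Inter_chain_in_Spec[OF chainB that]) blast+
    ultimately have "\<Inter>B \<in> B"
      using nP unfolding B_def by blast
    then show ?thesis by blast
  qed
  have greatest: "\<exists>Q\<in>A. \<forall>Q'\<in>A. Q' \<subseteq> Q" if ne: "A \<noteq> {}"
  proof -
    \<comment> \<open>\<open>M\<close> encodes lying below all of \<open>B\<close>: the complement
      of the least member of \<open>B\<close>, or just {1} when there is no upper bound to
      respect.\<close>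
    have "\<exists>M. m_system R M \<and> \<one>\<^bsub>R\<^esub> \<in> M \<and> (\<forall>Q\<in>A. Q \<inter> M = {}) \<and>
      (\<forall>N\<in>Spec R. N \<inter> M = {} \<longrightarrow> (\<forall>Q\<in>B. N \<subseteq> Q))"
    proof (cases "B = {}")
      case True
      have "\<forall>Q\<in>A. Q \<inter> {\<one>\<^bsub>R\<^esub>} = {}"
        using CR Spec_one_notin unfolding A_def by blast
      then show ?thesis using True R.m_system_one by blast
    next
      case False
      then obtain Q where Q: "Q \<in> B" "\<forall>Q'\<in>B. Q \<subseteq> Q'" using least by blast
      then have QR: "Q \<in> Spec R" using CR unfolding B_def by blast
      show ?thesis
      proof (intro exI[of _ "carrier R - Q"] conjI ballI impI)
        fix N Q' assume "N \<in> Spec R" "N \<inter> (carrier R - Q) = {}" "Q' \<in> B"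
        then show "N \<subseteq> Q'" using Spec_subset_carrier[of N R] Q(2) by blast
      qed (use Q(1) below m_system_Compl_prime[OF QR] Spec_one_notin[OF QR] in blast)+
    qed
    then obtain M where M: "m_system R M" "\<one>\<^bsub>R\<^esub> \<in> M" and MA: "\<forall>Q\<in>A. Q \<inter> M = {}"
      and MB: "\<forall>N\<in>Spec R. N \<inter> M = {} \<longrightarrow> (\<forall>Q\<in>B. N \<subseteq> Q)"
      by (elim exE conjE) (rule that)
    have "preim S f Q \<subseteq> P" if "Q \<in> A" for Q using that unfolding A_def by blast
    then obtain N where N: "N \<in> Spec R" "\<Union>A \<subseteq> N" "N \<inter> M = {}" "preim S f N \<subseteq> P"
      using ex_prime_above_chain[OF P chainA ne _ M] MA by blast
    \<comment> \<open>N fits the gap. Being in \<open>C\<close> and contracting into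
      \<open>P\<close>, it belongs to \<open>A\<close>, and it contains every member of
      \<open>A\<close>.\<close>
    have "N \<in> C" using N(2) MB[rule_format, OF N(1,3)] by (intro gap[OF N(1)]) auto
    then have "N \<in> A" using nP N(4) unfolding A_def by blast
    then show ?thesis using N(2) by blast
  qed
  \<comment> \<open>Otherwise \<open>gap\<close> would put every prime of R into \<open>C\<close>,
    and \<open>split\<close> into \<open>A\<close> or \<open>B\<close>. A prime exists because R is
    nontrivial: separate the zero ideal from {1}.\<close>
  have "A \<noteq> {} \<or> B \<noteq> {}"
  proof (rule ccontr)
    assume "\<not> ?thesis"
    moreover have "\<exists>N\<in>Spec R. {\<zero>\<^bsub>R\<^esub>} \<subseteq> N \<and> N \<inter> {\<one>\<^bsub>R\<^esub>} = {}"
      using nontriv by (intro R.ex_prime_avoiding_m_system R.zeroideal R.m_system_one) auto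
    ultimately show False using gap split by blast
  qed
  then consider (A) "A \<noteq> {}" "B = {}" | (B) "A = {}" "B \<noteq> {}" | (AB) "A \<noteq> {}" "B \<noteq> {}"
    by blast
  then show False
  proof cases
    case A
    then obtain Q where Q: "Q \<in> A" "\<forall>Q'\<in>A. Q' \<subseteq> Q" using greatest by blast
    then have "Q \<in> Spec R" "preim S f Q \<subset> P" using CR unfolding A_def by auto
    then obtain N where "N \<in> Spec R" "Q \<subset> N" "lies_over S f N P"
      using GU P preim_in_Spec unfolding GU_def lies_over_def by blast
    \<comment> \<open>A prime above the greatest member of \<open>A\<close> is above all of
      \<open>A\<close>, and the condition on the empty \<open>B\<close> is vacuous; the next case is
      dual.\<close>
    then show False using no_gap Q A by blast
  next
    case B
    then obtain Q where Q: "Q \<in> B" "\<forall>Q'\<in>B. Q \<subseteq> Q'" using least by blast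
    then have "Q \<in> Spec R" "P \<subset> preim S f Q" using CR unfolding B_def by auto
    then obtain N where "N \<in> Spec R" "N \<subset> Q" "lies_over S f N P"
      using GD P preim_in_Spec unfolding GD_def lies_over_def by blast
    then show False using no_gap Q B by blast
  next
    case AB
    obtain Q1 where Q1: "Q1 \<in> A" "\<forall>Q'\<in>A. Q' \<subseteq> Q1" using greatest AB by blast
    obtain Q3 where Q3: "Q3 \<in> B" "\<forall>Q'\<in>B. Q3 \<subseteq> Q'" using least AB by blast
    have Q: "Q1 \<in> Spec R" "Q3 \<in> Spec R" "preim S f Q1 \<subset> P" "P \<subset> preim S f Q3" "Q1 \<subset> Q3"
      using Q1 Q3 CR below[OF Q1(1) Q3(1)] unfolding A_def B_def by auto
    have "\<exists>N\<in>Spec R. Q1 \<subset> N \<and> N \<subset> Q3 \<and> lies_over S f N P"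
      by (rule SGB[unfolded SGB_def, rule_format,
            OF preim_in_Spec[OF Q(1)] P preim_in_Spec[OF Q(2)] Q(1,2)])
        (use Q(3-5) in \<open>simp add: lies_over_def\<close>)
    then obtain N where N: "N \<in> Spec R" "Q1 \<subseteq> N" "N \<subseteq> Q3" "lies_over S f N P"
      by (elim bexE conjE psubsetE) (rule that)
    have "\<forall>Q\<in>A. Q \<subseteq> N" "\<forall>Q\<in>B. N \<subseteq> Q"
      using Q1(2) Q3(2) N(2,3) by (meson subset_trans)+
    then show False using no_gap N(1,4) by blast
  qed
qed

end

theorem theorem1p14:
  fixes S :: "('a, 'm) ring_scheme" and R :: "('b, 'n) ring_scheme"
    and f :: "'a \<Rightarrow> 'b" and \<C> :: "'b set set"
  assumes "ring S" and "\<one>\<^bsub>S\<^esub> \<noteq> \<zero>\<^bsub>S\<^esub>"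
    and "ring R" and "\<one>\<^bsub>R\<^esub> \<noteq> \<zero>\<^bsub>R\<^esub>"
    and "f \<in> ring_hom S R"
    and "f ` carrier S \<subseteq> ring_center R"
    and "GU S R f" and "GD S R f" and "SGB S R f"
    and "subset.maxchain (Spec R) \<C>"
  shows "subset.maxchain (Spec S) {preim S f Q | Q. Q \<in> \<C>} \<and>
    (\<exists>\<D>. subset.maxchain (Spec S) \<D> \<and> chain_cover S R f \<C> \<D>)"
proof -
  interpret central_hom S R f
    using assms(1,3,5,6) by (simp add: central_hom_def central_hom_axioms_def)
  let ?D = "{preim S f Q | Q. Q \<in> \<C>}"
  have chain: "subset.chain (Spec R) \<C>" using assms(10) unfolding subset.maxchain_def by blast
  have chainD: "subset.chain (Spec S) ?D"
    unfolding subset_chain_def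
  proof (intro conjI ballI)
    show "?D \<subseteq> Spec S" using chain preim_in_Spec unfolding subset_chain_def by blast
    fix P P' assume "P \<in> ?D" "P' \<in> ?D"
    then obtain Q Q' where "Q \<in> \<C>" "Q' \<in> \<C>" "P = preim S f Q" "P' = preim S f Q'" by blast
    moreover from this have "Q \<subseteq> Q' \<or> Q' \<subseteq> Q" using chain unfolding subset_chain_def by blast
    ultimately show "P \<subseteq> P' \<or> P' \<subseteq> P" unfolding preim_def by blast
  qed
  \<comment> \<open>Every member of a chain extending \<open>?D\<close> is comparable with all
    contractions, hence is itself one of them; so no extension is proper.\<close>
  have "P \<in> ?D" if E: "subset.chain (Spec S) E" "?D \<subseteq> E" "P \<in> E" for E P
  proof -
    have "P \<in> Spec S" using E unfolding subset_chain_def by blast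
    moreover have "preim S f Q \<subseteq> P \<or> P \<subseteq> preim S f Q" if "Q \<in> \<C>" for Q
      using E that unfolding subset_chain_def by blast
    ultimately show ?thesis
      using maxchain_lies_over_comparable[OF assms(7,8,9,4,10)] by blast
  qed
  then have max: "subset.maxchain (Spec S) ?D"
    using chainD unfolding subset.maxchain_def by blast
  moreover have "chain_cover S R f \<C> ?D"
    using chain chainD unfolding chain_cover_def by blast
  ultimately show ?thesis by blast
qed

end
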